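(* For any integers $q\ge p\ge 3$, if $\bar{d}(K(2,p,q))=2$, then $q\le \binom{p}{\lfloor p/2\rfloor}$.
   Context: $K(2,p,q)$ is the complete tripartite graph with partite sets of sizes $2$, $p$, $q$. For a connected bridgeless graph $G$, $\mathscr{D}(G)$ is the family of strong orientations of $G$ (orientations in which every two vertices are mutually reachable), and the orientation number is $\bar d(G)=\min\{d(D): D\in\mathscr{D}(G)\}$, where $d(D)$ is the diameter of the digraph $D$ (maximum over ordered pairs of vertices of the length of a shortest directed path). *)

theory Defs
  imports "Graph_Theory.Digraph_Component" "Graph_Theory.Shortest_Path"
begin

text \<open>
  As in the Graph Theory library, an undirected simple graph is a finite, loop-free, symmetric
  digraph (locale \<open>pair_graph\<close>): the edge \<open>uv\<close> is the pair of arcs \<open>(u, v)\<close>, \<open>(v, u)\<close>.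
\<close>

text \<open>
  The first component of a vertex names its partite set.
\<close>
definition complete_tripartite :: "nat \<Rightarrow> nat \<Rightarrow> nat \<Rightarrow> (nat \<times> nat) pair_pre_digraph" where
  "complete_tripartite a b c =
    (let V = {0} \<times> {..<a} \<union> {1} \<times> {..<b} \<union> {2} \<times> {..<c}
     in \<lparr>pverts = V, parcs = {(u, v). u \<in> V \<and> v \<in> V \<and> fst u \<noteq> fst v}\<rparr>)"

definition orientation :: "'a pair_pre_digraph \<Rightarrow> 'a pair_pre_digraph \<Rightarrow> bool" where
  "orientation D G \<longleftrightarrow> spanning (with_proj D) (with_proj G) \<and>
    (\<forall>(u, v) \<in> parcs G. ((u, v) \<in> parcs D) \<noteq> ((v, u) \<in> parcs D))"

definition strong_orientations :: "'a pair_pre_digraph \<Rightarrow> 'a pair_pre_digraph set" where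
  "strong_orientations G = {D. orientation D G \<and> strongly_connected (with_proj D)}"

text \<open>
  \<open>wf_digraph.\<mu>\<close> is the infimum of the costs of the directed walks from \<open>u\<close> to \<open>v\<close>
  (infinite if there is none); with unit costs this is the length of a shortest directed path.
\<close>
definition digraph_dist :: "('a, 'b) pre_digraph \<Rightarrow> 'a \<Rightarrow> 'a \<Rightarrow> ereal" where
  "digraph_dist D u v = wf_digraph.\<mu> D (\<lambda>_. 1) u v"

definition digraph_diameter :: "('a, 'b) pre_digraph \<Rightarrow> ereal" where
  "digraph_diameter D = (SUP u \<in> verts D. SUP v \<in> verts D. digraph_dist D u v)"

text \<open>
  The infimum over an empty family is infinite; otherwise it is attained, see
  \<open>orientation_number_attained\<close> below.
\<close>
definition orientation_number :: "'a pair_pre_digraph \<Rightarrow> ereal" where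
  "orientation_number G = (INF D \<in> strong_orientations G. digraph_diameter (with_proj D))"

lemma pair_graph_complete_tripartite: "pair_graph (complete_tripartite a b c)"
proof -
  let ?G = "complete_tripartite a b c"
  have fin: "finite (pverts ?G)"
    by (simp add: complete_tripartite_def Let_def)
  have "parcs ?G \<subseteq> pverts ?G \<times> pverts ?G"
    by (auto simp: complete_tripartite_def Let_def)
  then have "finite (parcs ?G)"
    using fin by (meson finite_SigmaI finite_subset)
  moreover have "symmetric (with_proj ?G)"
    by (auto simp: symmetric_def sym_def complete_tripartite_def Let_def)
  ultimately show ?thesis
    using fin by unfold_locales (auto simp: complete_tripartite_def Let_def)
qed

lemma orientation_number_attained:
  assumes "pair_graph G" "strong_orientations G \<noteq> {}"
  shows "\<exists>D \<in> strong_orientations G. digraph_diameter (with_proj D) = orientation_number G"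
proof -
  interpret pair_graph G by fact
  have "strong_orientations G \<subseteq> (\<lambda>A. \<lparr>pverts = pverts G, parcs = A\<rparr>) ` Pow (parcs G)"
  proof
    fix D assume "D \<in> strong_orientations G"
    then have "pverts D = pverts G" "parcs D \<subseteq> parcs G"
      by (auto simp: strong_orientations_def orientation_def spanning_def subgraph_def)
    then show "D \<in> (\<lambda>A. \<lparr>pverts = pverts G, parcs = A\<rparr>) ` Pow (parcs G)"
      by (intro image_eqI[where x = "parcs D"]) auto
  qed
  then have "finite (strong_orientations G)"
    using pair_finite_arcs by (meson finite_Pow_iff finite_imageI finite_subset)
  then have "orientation_number G \<in> (\<lambda>D. digraph_diameter (with_proj D)) ` strong_orientations G"
    unfolding orientation_number_def using assms(2)
    by (subst Min_Inf[symmetric]) (auto intro!: Min_in simp del: Min_Inf)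
  then show ?thesis by auto
qed

end

theory Submission
  imports Defs
begin

text \<open>
  Let \<open>a\<close>, \<open>b\<close> be the two vertices of the smallest partite set and let \<open>P\<close>, \<open>Q\<close> be the other two.
  In an orientation of diameter two, out-neighbourhoods of vertices of \<open>Q\<close> form an antichain in
  \<open>P \<union> {a, b}\<close>. The paths of length two between \<open>P\<close> and \<open>Q\<close> run through \<open>a\<close> or \<open>b\<close>, so an \<open>x \<in> Q\<close>
  that points to neither of them dominates all of \<open>P\<close>, one that points to both dominates nothing of
  \<open>P\<close>, and one that points to \<open>a\<close> only satisfies \<open>P - N a \<subseteq> N x \<subseteq> P - N b\<close>, where \<open>N v\<close> is the
  out-neighbourhood of \<open>v\<close> in \<open>P\<close>. If both mixed types occur or neither does, every type occurs at
  most once and one of the four types is missing, so that \<open>Q\<close> has at most three elements. If only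
  one mixed type occurs, the at most one exceptional vertex can be given a new neighbourhood in \<open>P\<close>, a
  singleton or the complement of one, such that the neighbourhoods in \<open>P\<close> form an antichain, and
  Sperner's theorem applies.
\<close>

section \<open>Sperner's theorem\<close>

text \<open>
  The induction deletes a point \<open>e\<close> of the ground set and sums over all \<open>e\<close>: a member \<open>X\<close> of the
  family survives for \<open>n - card X\<close> choices of \<open>e\<close>.
\<close>

lemma lubell_yamamoto_meshalkin:
  assumes "finite P" "F \<subseteq> Pow P" "\<And>X Y. X \<in> F \<Longrightarrow> Y \<in> F \<Longrightarrow> X \<subseteq> Y \<Longrightarrow> X = Y"
  shows "(\<Sum>X\<in>F. 1 / real (card P choose card X)) \<le> 1"
  using assms
proof (induction "card P" arbitrary: P F)
  case 0
  then have "F \<subseteq> {{}}" by auto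
  then show ?case using 0 by (cases "F = {}") (auto simp: subset_singleton_iff)
next
  case (Suc n)
  show ?case
  proof (cases "P \<in> F")
    case True
    then have "F = {P}" using Suc.prems by blast
    then show ?thesis by simp
  next
    case False
    let ?G = "\<lambda>e. {X \<in> F. e \<notin> X}"
    have finF: "finite F" using Suc.prems by (meson finite_Pow_iff finite_subset)
    have IH: "(\<Sum>X\<in>?G e. 1 / real (n choose card X)) \<le> 1" if "e \<in> P" for e
    proof -
      have "n = card (P - {e})" using Suc.hyps Suc.prems that by simp
      moreover from this have "(\<Sum>X\<in>?G e. 1 / real (card (P - {e}) choose card X)) \<le> 1"
        using Suc.prems by (intro Suc.hyps) auto
      ultimately show ?thesis by simp
    qed
    have weight: "real (Suc n) * (1 / real (Suc n choose card X)) =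
        (\<Sum>e\<in>P - X. 1 / real (n choose card X))" if X: "X \<in> F" for X
    proof -
      have sub: "X \<subseteq> P" using X Suc.prems by auto
      \<comment> \<open>Strictness keeps \<open>n choose card X\<close> positive; for
        \<open>X = P\<close> it would be 0.\<close>
      then have "card X < card P" using False X Suc.prems
        by (metis psubsetI psubset_card_mono)
      then have lt: "card X < Suc n" using Suc.hyps by simp
      have cd: "card (P - X) = Suc n - card X"
        using sub Suc.hyps Suc.prems by (metis card_Diff_subset finite_subset)
      have "real ((Suc n - card X) * (Suc n choose card X)) = real (Suc n * (n choose card X))"
        using binomial_absorb_comp[of "Suc n" "card X"] by simp
      moreover have "n choose card X > 0" "Suc n choose card X > 0" using lt by auto
      ultimately show ?thesis using cd by (simp add: divide_simps) (simp add: algebra_simps)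
    qed
    have "real (Suc n) * (\<Sum>X\<in>F. 1 / real (Suc n choose card X)) =
        (\<Sum>X\<in>F. \<Sum>e\<in>P - X. 1 / real (n choose card X))"
      unfolding sum_distrib_left by (intro sum.cong refl weight)
    also have "\<dots> = (\<Sum>X\<in>F. \<Sum>e | e \<in> P \<and> e \<notin> X. 1 / real (n choose card X))"
      by (simp add: set_diff_eq)
    also have "\<dots> = (\<Sum>e\<in>P. \<Sum>X\<in>?G e. 1 / real (n choose card X))"
      by (rule sum.swap_restrict) (use finF Suc.prems in auto)
    also have "\<dots> \<le> (\<Sum>e\<in>P. 1)" by (intro sum_mono IH)
    also have "\<dots> = real (Suc n) * 1" using Suc.hyps by simp
    finally have "(\<Sum>X\<in>F. 1 / real (Suc n choose card X)) \<le> 1"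
      by (subst (asm) mult_le_cancel_left_pos) auto
    then show ?thesis using Suc.hyps by simp
  qed
qed

text \<open>The central binomial coefficient is the largest, so each term of the LYM sum is at least
  \<open>1 / ?m\<close>.\<close>

theorem sperner:
  assumes "finite P" "F \<subseteq> Pow P" "\<And>X Y. X \<in> F \<Longrightarrow> Y \<in> F \<Longrightarrow> X \<subseteq> Y \<Longrightarrow> X = Y"
  shows "card F \<le> card P choose (card P div 2)"
proof -
  let ?m = "card P choose (card P div 2)"
  have pos: "?m > 0" by simp
  have "real (card F) / real ?m = (\<Sum>X\<in>F. 1 / real ?m)" by simp
  also have "\<dots> \<le> (\<Sum>X\<in>F. 1 / real (card P choose card X))"
  proof (rule sum_mono)
    fix X assume "X \<in> F"
    then have "card X \<le> card P" using assms by (meson PowD card_mono subsetD)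
    then have "card P choose card X > 0" by simp
    then show "1 / real ?m \<le> 1 / real (card P choose card X)"
      using binomial_maximum[of "card P" "card X"] by (intro divide_left_mono) auto
  qed
  also have "\<dots> \<le> 1" by (rule lubell_yamamoto_meshalkin[OF assms])
  finally show ?thesis using pos by (simp add: divide_simps split: if_splits)
qed

section \<open>Orientations of diameter two\<close>

lemma walk_of_length_le_two:
  assumes "wf_digraph (with_proj D)" "digraph_diameter (with_proj D) \<le> 2"
    and "u \<in> pverts D" "v \<in> pverts D" "u \<noteq> v"
  shows "(u, v) \<in> parcs D \<or> (\<exists>w. (u, w) \<in> parcs D \<and> (w, v) \<in> parcs D)"
proof -
  interpret wf_digraph "with_proj D" by fact
  have "digraph_dist (with_proj D) u v \<le> digraph_diameter (with_proj D)"
    unfolding digraph_diameter_def using assms by (intro SUP_upper2[of u] SUP_upper2[of v]) auto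
  \<comment> \<open>An infimum strictly below 3 is witnessed by a walk of cost below 3.\<close>
  also have "\<dots> < 3"
    using assms(2) by (rule le_less_trans) simp
  finally have "(INF p\<in>{p. awalk u p v}. ereal (awalk_cost (\<lambda>_. 1) p)) < 3"
    by (simp add: digraph_dist_def \<mu>_def)
  then obtain p where p: "awalk u p v" "ereal (awalk_cost (\<lambda>_. 1) p) < 3"
    by (auto simp: INF_less_iff)
  have "awalk_cost (\<lambda>_. 1) p = length p" by (induction p) auto
  with p have "length p < 3" by simp
  with p(1) \<open>u \<noteq> v\<close> show ?thesis
    by (cases p; cases "tl p"; cases "tl (tl p)") (auto simp: awalk_Nil_iff awalk_Cons_iff)
qed

text \<open>
  \<open>E u v\<close> is an arc from \<open>u\<close> to \<open>v\<close>. Each of the last five assumptions is the existence of a path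
  of length two, with arcs \<open>E w u\<close> written as \<open>\<not> E u w\<close> so that only out-neighbourhoods of \<open>a\<close>, \<open>b\<close> and
  the vertices of \<open>Q\<close> occur.
\<close>
locale diameter_two_tripartite =
  fixes E :: "'a \<Rightarrow> 'a \<Rightarrow> bool" and a b :: 'a and P Q :: "'a set"
  assumes finite_P: "finite P" and card_P: "3 \<le> card P"
    and QQ: "\<And>x y. x \<in> Q \<Longrightarrow> y \<in> Q \<Longrightarrow> x \<noteq> y \<Longrightarrow> \<exists>w \<in> P \<union> {a, b}. E x w \<and> \<not> E y w"
    and QV: "\<And>x v. x \<in> Q \<Longrightarrow> v \<in> {a, b} \<Longrightarrow> E x v \<Longrightarrow> \<exists>w \<in> P. E v w \<and> \<not> E x w"
    and VQ: "\<And>x v. x \<in> Q \<Longrightarrow> v \<in> {a, b} \<Longrightarrow> \<not> E x v \<Longrightarrow> \<exists>w \<in> P. E x w \<and> \<not> E v w"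
    and QP: "\<And>x w. x \<in> Q \<Longrightarrow> w \<in> P \<Longrightarrow> E x w \<Longrightarrow> \<exists>v \<in> {a, b}. \<not> E v w \<and> \<not> E x v"
    and PQ: "\<And>x w. x \<in> Q \<Longrightarrow> w \<in> P \<Longrightarrow> \<not> E x w \<Longrightarrow> \<exists>v \<in> {a, b}. E v w \<and> E x v"
begin

lemma swap: "diameter_two_tripartite E b a P Q"
  using diameter_two_tripartite_axioms
  unfolding diameter_two_tripartite_def insert_commute[of b a] .

section \<open>Bounding Q by the types of its vertices\<close>

lemma three_le_central_binomial: "3 \<le> card P choose (card P div 2)"
  using card_P binomial_maximum[of "card P" 1] by simp

lemma card_Q_le_if_types_distinct:
  assumes "inj_on (\<lambda>x. (E x a, E x b)) Q" "t \<notin> (\<lambda>x. (E x a, E x b)) ` Q"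
  shows "card Q \<le> card P choose (card P div 2)"
proof -
  have "card Q = card ((\<lambda>x. (E x a, E x b)) ` Q)" using assms by (simp add: card_image)
  also have "\<dots> \<le> card (UNIV - {t})" using assms by (intro card_mono) auto
  also have "\<dots> = 3" by (cases t) (simp add: card_cartesian_product flip: UNIV_Times_UNIV)
  finally show ?thesis using three_le_central_binomial by simp
qed

lemma card_Q_le_if_types_agree:
  assumes "(\<exists>x\<in>Q. E x a \<and> \<not> E x b) \<longleftrightarrow> (\<exists>x\<in>Q. E x b \<and> \<not> E x a)"
  shows "card Q \<le> card P choose (card P div 2)"
proof -
  have inj: "inj_on (\<lambda>x. (E x a, E x b)) Q"
  proof (rule inj_onI, rule ccontr)
    fix x y assume xy: "x \<in> Q" "y \<in> Q" "(E x a, E x b) = (E y a, E y b)" "x \<noteq> y"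
    then obtain w where w: "w \<in> P" "E x w" "\<not> E y w" using QQ by blast
    \<comment> \<open>As \<open>x\<close> and \<open>y\<close> share a type, the two paths have
      different middle vertices, so the type is mixed.\<close>
    have "\<not> E a w \<and> \<not> E x a \<or> \<not> E b w \<and> \<not> E x b" using QP xy w by blast
    moreover have "E a w \<and> E x a \<or> E b w \<and> E x b" using PQ[of y w] xy w by blast
    ultimately obtain z z' where z: "z \<in> Q" "E z a" "\<not> E z b" "z' \<in> Q" "E z' b" "\<not> E z' a"
      and ne: "E a w \<noteq> E b w"
      using assms xy by blast
    \<comment> \<open>\<open>z\<close> yields \<open>E b w \<longrightarrow> E a w\<close>, and
      \<open>z'\<close> the converse.\<close>
    have "E a w = E b w" using PQ[of z w] QP[of z w] PQ[of z' w] QP[of z' w] z w by blast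
    with ne show False by simp
  qed
  have "\<exists>t. t \<notin> (\<lambda>x. (E x a, E x b)) ` Q"
  proof (rule ccontr)
    assume "\<nexists>t. t \<notin> (\<lambda>x. (E x a, E x b)) ` Q"
    then have all: "\<And>s t. (s, t) \<in> (\<lambda>x. (E x a, E x b)) ` Q" by blast
    obtain x where x: "x \<in> Q" "E x a" "E x b" using all[of True True] by auto
    obtain y where y: "y \<in> Q" "\<not> E y a" "\<not> E y b" using all[of False False] by auto
    obtain z where z: "z \<in> Q" "E z a" "\<not> E z b" using all[of True False] by auto
    obtain z' where z': "z' \<in> Q" "\<not> E z' a" "E z' b" using all[of False True] by auto
    have eq: "E a w = E b w" if "w \<in> P" for w
      using PQ[of z w] QP[of z w] PQ[of z' w] QP[of z' w] z z' that by blast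
    \<comment> \<open>With both \<open>a\<close> and \<open>b\<close> dominating \<open>w\<close>, a
      path from \<open>w\<close> to \<open>y\<close> has no middle vertex, so \<open>E y w\<close>
      fails; but \<open>y\<close> has no arc to \<open>a\<close> or \<open>b\<close> to reach
      \<open>w\<close> through.\<close>
    obtain w where w: "w \<in> P" "E a w" using QV[of x a] x by blast
    then show False using eq PQ[of y w] QP[of y w] y by blast
  qed
  with inj show ?thesis using card_Q_le_if_types_distinct by blast
qed

lemma card_Q_le_if_one_type:
  assumes z: "z \<in> Q" "E z a" "\<not> E z b" and no_b: "\<not> (\<exists>x\<in>Q. E x b \<and> \<not> E x a)"
  shows "card Q \<le> card P choose (card P div 2)"
proof -
  define w0 where "w0 = (SOME w. w \<in> P \<and> \<not> E a w)"
  define w1 where "w1 = (SOME w. w \<in> P \<and> E b w)"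
  \<comment> \<open>Every mixed neighbourhood contains \<open>w0\<close> and avoids
    \<open>w1\<close> whenever the corresponding exceptional vertex exists; only then do these
    choices matter. This makes both replacement sets incomparable to the mixed ones.\<close>
  define g where "g x = (if \<not> E x a then P - {w0} else if E x b then {w1} else {w \<in> P. E x w})" for x
  have ba: "E a w" if "w \<in> P" "E b w" for w using PQ[of z w] QP[of z w] z that by blast
  have none: "\<not> E x b \<and> (\<forall>w\<in>P. E x w) \<and> (\<forall>w\<in>P. \<not> E b w) \<and> w0 \<in> P \<and> \<not> E a w0"
    if x: "x \<in> Q" "\<not> E x a" for x
  proof -
    have xb: "\<not> E x b" using no_b x by blast
    have all: "\<forall>w\<in>P. E x w" using PQ[of x] x xb by blast
    moreover have "\<forall>w\<in>P. \<not> E b w" using QP[of x] x all ba by blast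
    moreover have "\<exists>w. w \<in> P \<and> \<not> E a w" using VQ[of x a] x by blast
    from someI_ex[OF this] have "w0 \<in> P \<and> \<not> E a w0" by (simp add: w0_def)
    ultimately show ?thesis using xb by blast
  qed
  have both: "(\<forall>w\<in>P. \<not> E x w) \<and> w1 \<in> P \<and> E b w1" if x: "x \<in> Q" "E x a" "E x b" for x
  proof -
    have "\<exists>w. w \<in> P \<and> E b w" using QV[of x b] x by blast
    from someI_ex[OF this] have "w1 \<in> P \<and> E b w1" by (simp add: w1_def)
    then show ?thesis using QP[of x] x by blast
  qed
  have mixed: "(\<forall>w\<in>P. \<not> E a w \<longrightarrow> E x w) \<and> (\<forall>w\<in>P. E b w \<longrightarrow> \<not> E x w)"
    if "x \<in> Q" "E x a" "\<not> E x b" for x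
    using PQ[of x] QP[of x] that by blast
  have antichain: "\<not> g x \<subseteq> g y" if xy: "x \<in> Q" "y \<in> Q" "x \<noteq> y" for x y
  proof -
    obtain w where w: "w \<in> P \<union> {a, b}" "E x w" "\<not> E y w" using QQ[OF xy] by blast
    show ?thesis
    proof (cases "E x a")
      case False
      note x = none[OF xy(1) False]
      have wP: "w \<in> P" using w x False by blast
      have ya: "E y a" using none[OF xy(2)] wP w by blast
      \<comment> \<open>The two exceptional types exclude each other: one forbids arcs from
        \<open>b\<close> into \<open>P\<close>, the other supplies one to \<open>w1\<close>.\<close>
      have yb: "\<not> E y b" using both[OF xy(2) ya] x by blast
      have "w \<noteq> w0" using mixed[OF xy(2) ya yb] x w by blast
      then show ?thesis using False ya yb w wP by (auto simp: g_def)
    next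
      case True
      note xa = this
      show ?thesis
      proof (cases "E x b")
        case True
        note x = both[OF xy(1) xa True]
        have ya: "E y a" using none[OF xy(2)] x by blast
        have yb: "\<not> E y b" using w x ya by blast
        have "\<not> E y w1" using mixed[OF xy(2) ya yb] x by blast
        then show ?thesis using xa True ya yb by (simp add: g_def)
      next
        case False
        note x = mixed[OF xy(1) xa False]
        show ?thesis
        proof (cases "E y a")
          case True
          then have wP: "w \<in> P" using w False by blast
          have "E y b \<Longrightarrow> w \<noteq> w1" using both[OF xy(2) True] x w by blast
          then show ?thesis using xa False True w wP by (auto simp: g_def)
        next
          case ya: False
          have "w0 \<in> P" "E x w0" using none[OF xy(2) ya] x by auto
          then show ?thesis using xa False ya by (auto simp: g_def)
        qed
      qed
    qed
  qed
  have "inj_on g Q" by (intro inj_onI) (metis antichain order_refl)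
  then have "card Q = card (g ` Q)" by (simp add: card_image)
  also have "\<dots> \<le> card P choose (card P div 2)"
  proof (rule sperner[OF finite_P])
    show "g ` Q \<subseteq> Pow P" using both by (auto simp: g_def split: if_splits)
    show "X = Y" if "X \<in> g ` Q" "Y \<in> g ` Q" "X \<subseteq> Y" for X Y using antichain that by blast
  qed
  finally show ?thesis .
qed

text \<open>If exactly one mixed type occurs, exchanging \<open>a\<close> and \<open>b\<close> makes
  it the one pointing to \<open>a\<close>.\<close>

lemma card_Q_le: "card Q \<le> card P choose (card P div 2)"
proof -
  interpret sw: diameter_two_tripartite E b a P Q by (rule swap)
  show ?thesis
    using card_Q_le_if_types_agree card_Q_le_if_one_type sw.card_Q_le_if_one_type by blast
qed

end

section \<open>From an optimal orientation to the neighbourhood conditions\<close>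

theorem theorem2p3:
  fixes p q :: nat
  assumes "3 \<le> p" and "p \<le> q"
    and "orientation_number (complete_tripartite 2 p q) = 2"
  shows "q \<le> p choose (p div 2)"
proof -
  let ?G = "complete_tripartite 2 p q"
  \<comment> \<open>An empty family would have infimum \<open>\<infinity>\<close> instead of
    2.\<close>
  have "strong_orientations ?G \<noteq> {}"
    using assms(3) by (auto simp: orientation_number_def top_ereal_def)
  then obtain D where D: "D \<in> strong_orientations ?G" "digraph_diameter (with_proj D) = 2"
    using orientation_number_attained[OF pair_graph_complete_tripartite] assms(3) by metis
  define E where "E u v \<longleftrightarrow> (u, v) \<in> parcs D" for u v
  let ?V = "{0} \<times> {..<2} \<union> {1} \<times> {..<p} \<union> {2} \<times> {..<q} :: (nat \<times> nat) set"
  have ori: "spanning (with_proj D) (with_proj ?G)"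
      "\<And>u v. (u, v) \<in> parcs ?G \<Longrightarrow> ((u, v) \<in> parcs D) \<noteq> ((v, u) \<in> parcs D)"
    using D by (auto simp: strong_orientations_def orientation_def)
  have wf: "wf_digraph (with_proj D)" and verts: "pverts D = ?V"
    and arcs: "parcs D \<subseteq> parcs ?G"
    using ori(1) by (auto simp: spanning_def subgraph_def complete_tripartite_def Let_def)
  have E_parts: "u \<in> ?V \<and> v \<in> ?V \<and> fst u \<noteq> fst v" if "E u v" for u v
    using that arcs by (auto simp: E_def complete_tripartite_def Let_def)
  have E_total: "E v u \<longleftrightarrow> \<not> E u v" if "u \<in> ?V" "v \<in> ?V" "fst u \<noteq> fst v" for u v
    using ori(2)[of u v] that by (auto simp: E_def complete_tripartite_def Let_def)
  \<comment> \<open>Arcs join different partite sets, so the middle vertex avoids those of both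
    ends.\<close>
  have path: "\<exists>w\<in>?V. fst w \<noteq> fst u \<and> fst w \<noteq> fst v \<and> E u w \<and> \<not> E v w"
    if "u \<in> ?V" "v \<in> ?V" "u \<noteq> v" "\<not> E u v" for u v
  proof -
    have "\<exists>w. E u w \<and> E w v"
      using walk_of_length_le_two[OF wf, of u v] D that verts by (auto simp: E_def)
    then obtain w where w: "E u w" "E w v" by blast
    note parts = E_parts[OF w(1)] E_parts[OF w(2)]
    have "\<not> E v w" using E_total[of w v] parts w(2) by blast
    then show ?thesis using parts w by (intro bexI[of _ w]) auto
  qed
  let ?A = "{(0, 0), (0, 1)} :: (nat \<times> nat) set"
  let ?P = "{1} \<times> {..<p} :: (nat \<times> nat) set"
  let ?Q = "{2} \<times> {..<q} :: (nat \<times> nat) set"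
  have A: "v \<in> ?V \<and> fst v = 0" if "v \<in> ?A" for v using that by auto
  have P: "v \<in> ?V \<and> fst v = 1" if "v \<in> ?P" for v using that by auto
  have Q: "v \<in> ?V \<and> fst v = 2" if "v \<in> ?Q" for v using that by auto
  have in_A: "v \<in> ?A" if "v \<in> ?V" "fst v \<noteq> 1" "fst v \<noteq> 2" for v
    using that by (auto simp: less_2_cases_iff)
  have in_P: "v \<in> ?P" if "v \<in> ?V" "fst v \<noteq> 0" "fst v \<noteq> 2" for v
    using that by auto
  have in_PA: "v \<in> ?P \<union> ?A" if "v \<in> ?V" "fst v \<noteq> 2" for v
    using that by (auto simp: less_2_cases_iff)
  interpret diameter_two_tripartite E "(0, 0)" "(0, 1)" ?P ?Q
  proof
    show "finite ?P" "3 \<le> card ?P"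
      using assms(1) by (auto simp: card_cartesian_product)
  next
    fix x y assume xy: "x \<in> ?Q" "y \<in> ?Q" "x \<noteq> y"
    then have "\<not> E x y" using E_parts[of x y] Q by metis
    then obtain w where "w \<in> ?V" "fst w \<noteq> 2" "E x w" "\<not> E y w"
      using path[of x y] xy Q by metis
    then show "\<exists>w\<in>?P \<union> ?A. E x w \<and> \<not> E y w" using in_PA by metis
  next
    fix x v assume xv: "x \<in> ?Q" "v \<in> ?A" "E x v"
    then have "\<not> E v x" "v \<noteq> x" using E_total[of v x] A[of v] Q[of x] by auto
    then obtain w where "w \<in> ?V" "fst w \<noteq> 0" "fst w \<noteq> 2" "E v w" "\<not> E x w"
      using path[of v x] xv Q A by metis
    then show "\<exists>w\<in>?P. E v w \<and> \<not> E x w" using in_P by metis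
  next
    fix x v assume xv: "x \<in> ?Q" "v \<in> ?A" "\<not> E x v"
    then have "v \<noteq> x" using A[of v] Q[of x] by auto
    then obtain w where "w \<in> ?V" "fst w \<noteq> 0" "fst w \<noteq> 2" "E x w" "\<not> E v w"
      using path[of x v] xv Q A by metis
    then show "\<exists>w\<in>?P. E x w \<and> \<not> E v w" using in_P by metis
  next
    fix x w assume xw: "x \<in> ?Q" "w \<in> ?P" "E x w"
    then have "\<not> E w x" "w \<noteq> x" using E_total[of w x] P[of w] Q[of x] by auto
    then obtain v where v: "v \<in> ?V" "fst v \<noteq> 1" "fst v \<noteq> 2" "E w v" "\<not> E x v"
      using path[of w x] xw Q P by metis
    then have "\<not> E v w" using E_total[of v w] P[OF xw(2)] by auto
    then show "\<exists>v\<in>?A. \<not> E v w \<and> \<not> E x v" using in_A v by metis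
  next
    fix x w assume xw: "x \<in> ?Q" "w \<in> ?P" "\<not> E x w"
    then have "w \<noteq> x" using P[of w] Q[of x] by auto
    then obtain v where v: "v \<in> ?V" "fst v \<noteq> 1" "fst v \<noteq> 2" "E x v" "\<not> E w v"
      using path[of x w] xw Q P by metis
    then have "E v w" using E_total[of v w] P[OF xw(2)] by auto
    then show "\<exists>v\<in>?A. E v w \<and> E x v" using in_A v by metis
  qed
  show ?thesis using card_Q_le by (simp add: card_cartesian_product)
qed

end
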